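(* Let $f$ be a discrete Morse-Bott function on a Lefschetz complex $\mathbb{K}=(X,\dim,w)$, and let $g\colon\mathbb{K}\to\mathbb{R}$ be a function. Assume that for any cells $\alpha,\beta\in\mathbb{K}$ with $w(\alpha,\beta)\neq0$ or $w(\beta,\alpha)\neq0$ we have $$f(\alpha)<f(\beta)\iff g(\alpha)<g(\beta).$$ Then $g$ is a discrete Morse-Bott function on $\mathbb{K}$, $\mathbb{W}(\mathbb{K},f)=\mathbb{W}(\mathbb{K},g)$, and $R_t(\mathbb{K},f)=R_t(\mathbb{K},g)$.
   Context: A Lefschetz complex is a triple $\mathbb{K}=(X,\dim,w)$, where $X$ is a set (of cells), $\dim\colon X\to\mathbb{Z}_{\ge0}$ and $w\colon X\times X\to\mathbb{R}$ are functions, $\dim^{-1}(k)$ is finite for every $k$, and: (L1) $w(\tau,\sigma)\neq0$ implies $\dim\tau-\dim\sigma=1$; (L2) $\sum_{\sigma\in X}w(\tau,\sigma)w(\sigma,\nu)=0$ for all $\tau,\nu\in X$. $C_k(\mathbb{K})$ is the real vector space with basis the $k$-cells (cells of dimension $k$), $\partial_k(\tau)=\sum_\sigma w(\tau,\sigma)\sigma$ for a $k$-cell $\tau$ (sum over $(k-1)$-cells), $B_k(\mathbb{K})=\operatorname{im}\partial_{k+1}$. For $f\colon\mathbb{K}\to\mathbb{R}$ put $U^{\mathrm{snc}}(\sigma)=\#\{\tau\mid w(\tau,\sigma)\ne0,\ f(\sigma)>f(\tau)\}$, $D^{\mathrm{snc}}(\sigma)=\#\{\nu\mid w(\sigma,\nu)\ne0,\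 f(\sigma)<f(\nu)\}$. $f$ is a discrete Morse-Bott function if $U^{\mathrm{snc}}(\sigma)\le1$ and $D^{\mathrm{snc}}(\sigma)\le1$ for all $\sigma$. A cell $\sigma$ is weakly critical if $U^{\mathrm{snc}}(\sigma)+D^{\mathrm{snc}}(\sigma)=0$. The weakly critical complex $\mathbb{W}(\mathbb{K},f)$ is the Lefschetz complex whose cells are the weakly critical cells, with the restricted dimension function and with incidence function equal to $w(\tau,\sigma)$ if $f(\tau)=f(\sigma)$ and $0$ otherwise. With $d_k^{\mathrm{snc}}(\mathbb{K},f)=\#\{k\text{-cells }\sigma\mid D^{\mathrm{snc}}(\sigma)=1\}$, $$R_t(\mathbb{K},f)=\sum_{k=1}^\infty\bigl(\operatorname{rank}B_{k-1}(\mathbb{K})-d_k^{\mathrm{snc}}(\mathbb{K},f)-\operatorname{rank}B_{k-1}(\mathbb{W}(\mathbb{K},f))\bigr)t^{k-1}.$$ Equality of Lefschetz complexes means equality of cell sets, dimension functions and incidence functions. *)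

theory Defs
  imports
    "HOL-Analysis.Analysis"
    "HOL-Library.Poly_Mapping"
    "HOL-Computational_Algebra.Formal_Power_Series"
begin

record 'a cell_complex =
  cells :: "'a set"
  cell_dim :: "'a \<Rightarrow> nat"
  incidence :: "'a \<Rightarrow> 'a \<Rightarrow> real"

definition k_cells :: "'a cell_complex \<Rightarrow> nat \<Rightarrow> 'a set" where
  "k_cells K k = {\<sigma> \<in> cells K. cell_dim K \<sigma> = k}"

(* X itself may be infinite, where sum would be 0 by convention; therefore the sum in d_square
   runs over the nonzero terms only, which are finitely many by the first two axioms. *)
locale lefschetz_complex =
  fixes K :: "'a cell_complex"
  assumes finite_k_cells: "finite (k_cells K k)"
    and incidence_dim: "\<lbrakk>\<tau> \<in> cells K; \<sigma> \<in> cells K; incidence K \<tau> \<sigma> \<noteq> 0\<rbrakk>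
          \<Longrightarrow> int (cell_dim K \<tau>) - int (cell_dim K \<sigma>) = 1"
    and d_square: "\<lbrakk>\<tau> \<in> cells K; \<nu> \<in> cells K\<rbrakk>
          \<Longrightarrow> (\<Sum>\<sigma> | \<sigma> \<in> cells K \<and> incidence K \<tau> \<sigma> * incidence K \<sigma> \<nu> \<noteq> 0.
                 incidence K \<tau> \<sigma> * incidence K \<sigma> \<nu>) = 0"

(* HOL functions are total, so the values of the record components off the cell set
   must not enter into equality of complexes. *)
definition lefschetz_eq :: "'a cell_complex \<Rightarrow> 'a cell_complex \<Rightarrow> bool" where
  "lefschetz_eq K L \<longleftrightarrow>
     cells K = cells L \<and>
     (\<forall>\<sigma>\<in>cells K. cell_dim K \<sigma> = cell_dim L \<sigma>) \<and>
     (\<forall>\<tau>\<in>cells K. \<forall>\<sigma>\<in>cells K. incidence K \<tau> \<sigma> = incidence L \<tau> \<sigma>)"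

(* Real chains are the finitely supported functions from cells to the reals;
   the library provides no scalar multiplication for this type. *)
instantiation poly_mapping :: (type, real_vector) real_vector
begin

lift_definition scaleR_poly_mapping :: "real \<Rightarrow> ('a \<Rightarrow>\<^sub>0 'b) \<Rightarrow> 'a \<Rightarrow>\<^sub>0 'b"
  is "\<lambda>r c x. r *\<^sub>R c x"
  by (erule rev_finite_subset) auto

instance
  by standard (transfer; simp add: fun_eq_iff scaleR_add_right scaleR_add_left)+

end

definition chain_space :: "'a cell_complex \<Rightarrow> nat \<Rightarrow> ('a \<Rightarrow>\<^sub>0 real) set" where
  "chain_space K k = {c. Poly_Mapping.keys c \<subseteq> k_cells K k}"

lemma chain_space_eq_span:
  "chain_space K k = span ((\<lambda>\<sigma>. Poly_Mapping.single \<sigma> 1) ` k_cells K k)" (is "_ = span ?B")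
proof
  show "chain_space K k \<subseteq> span ?B"
  proof
    fix c :: "'a \<Rightarrow>\<^sub>0 real"
    assume "c \<in> chain_space K k"
    then have sub: "Poly_Mapping.keys c \<subseteq> k_cells K k"
      by (simp add: chain_space_def)
    have "c = (\<Sum>\<sigma>\<in>Poly_Mapping.keys c.
        Poly_Mapping.lookup c \<sigma> *\<^sub>R Poly_Mapping.single \<sigma> 1)"
      by (rule poly_mapping_eqI)
         (auto simp: lookup_sum scaleR_poly_mapping.rep_eq lookup_single when_def in_keys_iff if_distrib cong: if_cong)
    also have "\<dots> \<in> span ?B"
      using sub by (intro span_sum span_scale span_base) auto
    finally show "c \<in> span ?B" .
  qed
  have "subspace (chain_space K k)"
    unfolding subspace_def chain_space_def
    by (auto simp: in_keys_iff lookup_add scaleR_poly_mapping.rep_eq subset_iff)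
       (metis add.right_neutral)
  then show "span ?B \<subseteq> chain_space K k"
    by (rule span_minimal[rotated]) (auto simp: chain_space_def)
qed

lemma independent_cells:
  "independent ((\<lambda>\<sigma>. Poly_Mapping.single \<sigma> (1::real)) ` A)"
  unfolding independent_explicit_module
proof (intro allI impI)
  fix t and u :: "('a \<Rightarrow>\<^sub>0 real) \<Rightarrow> real" and x
  assume t: "finite t" "t \<subseteq> (\<lambda>\<sigma>. Poly_Mapping.single \<sigma> (1::real)) ` A"
    and eq: "(\<Sum>v\<in>t. u v *\<^sub>R v) = 0" and x: "x \<in> t"
  from x t(2) obtain \<sigma> where \<sigma>: "x = Poly_Mapping.single \<sigma> 1" by auto
  have "0 = Poly_Mapping.lookup (\<Sum>v\<in>t. u v *\<^sub>R v) \<sigma>"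
    using eq by simp
  also have "\<dots> = (\<Sum>v\<in>t. if v = Poly_Mapping.single \<sigma> 1 then u v else 0)"
    unfolding lookup_sum scaleR_poly_mapping.rep_eq
  proof (rule sum.cong[OF refl])
    fix v assume "v \<in> t"
    with t(2) obtain \<rho> where "v = Poly_Mapping.single \<rho> 1" by auto
    then show "u v *\<^sub>R Poly_Mapping.lookup v \<sigma> = (if v = Poly_Mapping.single \<sigma> 1 then u v else 0)"
      by (auto simp: lookup_single when_def dest: arg_cong[where f = Poly_Mapping.keys])
  qed
  also have "\<dots> = u (Poly_Mapping.single \<sigma> 1)"
    using t(1) x \<sigma> by simp
  finally show "u x = 0" by (simp add: \<sigma>)
qed

(* The faces of a k-cell are selected by cell_dim K \<sigma> + 1 = k rather than by k - 1,
   as subtraction is truncated for k = 0. *)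
definition boundary :: "'a cell_complex \<Rightarrow> nat \<Rightarrow> ('a \<Rightarrow>\<^sub>0 real) \<Rightarrow> ('a \<Rightarrow>\<^sub>0 real)" where
  "boundary K k c =
     (\<Sum>\<tau>\<in>Poly_Mapping.keys c. Poly_Mapping.lookup c \<tau> *\<^sub>R
        (\<Sum>\<sigma> | \<sigma> \<in> cells K \<and> cell_dim K \<sigma> + 1 = k.
           incidence K \<tau> \<sigma> *\<^sub>R Poly_Mapping.single \<sigma> 1))"

definition boundaries :: "'a cell_complex \<Rightarrow> nat \<Rightarrow> ('a \<Rightarrow>\<^sub>0 real) set" where
  "boundaries K k = boundary K (k + 1) ` chain_space K (k + 1)"

definition U_snc :: "'a cell_complex \<Rightarrow> ('a \<Rightarrow> real) \<Rightarrow> 'a \<Rightarrow> nat" where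
  "U_snc K f \<sigma> = card {\<tau> \<in> cells K. incidence K \<tau> \<sigma> \<noteq> 0 \<and> f \<sigma> > f \<tau>}"

definition D_snc :: "'a cell_complex \<Rightarrow> ('a \<Rightarrow> real) \<Rightarrow> 'a \<Rightarrow> nat" where
  "D_snc K f \<sigma> = card {\<nu> \<in> cells K. incidence K \<sigma> \<nu> \<noteq> 0 \<and> f \<sigma> < f \<nu>}"

definition discrete_morse_bott :: "'a cell_complex \<Rightarrow> ('a \<Rightarrow> real) \<Rightarrow> bool" where
  "discrete_morse_bott K f \<longleftrightarrow> (\<forall>\<sigma>\<in>cells K. U_snc K f \<sigma> \<le> 1 \<and> D_snc K f \<sigma> \<le> 1)"

definition weakly_critical :: "'a cell_complex \<Rightarrow> ('a \<Rightarrow> real) \<Rightarrow> 'a \<Rightarrow> bool" where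
  "weakly_critical K f \<sigma> \<longleftrightarrow> U_snc K f \<sigma> + D_snc K f \<sigma> = 0"

definition weakly_critical_complex :: "'a cell_complex \<Rightarrow> ('a \<Rightarrow> real) \<Rightarrow> 'a cell_complex" where
  "weakly_critical_complex K f =
     \<lparr>cells = {\<sigma> \<in> cells K. weakly_critical K f \<sigma>},
      cell_dim = cell_dim K,
      incidence = (\<lambda>\<tau> \<sigma>. if f \<tau> = f \<sigma> then incidence K \<tau> \<sigma> else 0)\<rparr>"

lemma lefschetz_weakly_critical_complex:
  assumes "lefschetz_complex K" and mb: "discrete_morse_bott K f"
  shows "lefschetz_complex (weakly_critical_complex K f)"
proof -
  interpret lefschetz_complex K by fact
  let ?W = "{\<sigma> \<in> cells K. weakly_critical K f \<sigma>}"
  have face_dim: "cell_dim K \<tau> = cell_dim K \<sigma> + 1"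
    if "\<tau> \<in> cells K" "\<sigma> \<in> cells K" "incidence K \<tau> \<sigma> \<noteq> 0" for \<tau> \<sigma>
    using incidence_dim[OF that] by linarith
  have fin_U: "finite {\<tau> \<in> cells K. incidence K \<tau> \<sigma> \<noteq> 0 \<and> P \<tau>}" if "\<sigma> \<in> cells K" for \<sigma> P
    by (rule finite_subset[OF _ finite_k_cells[of "cell_dim K \<sigma> + 1"]])
       (use face_dim that in \<open>auto simp: k_cells_def\<close>)
  have fin_D: "finite {\<nu> \<in> cells K. incidence K \<sigma> \<nu> \<noteq> 0 \<and> P \<nu>}" if "\<sigma> \<in> cells K" for \<sigma> P
    by (rule finite_subset[OF _ finite_k_cells[of "cell_dim K \<sigma> - 1"]])
       (use face_dim that in \<open>auto simp: k_cells_def\<close>)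
  have U0: "f \<sigma> \<le> f \<tau>" if "\<sigma> \<in> ?W" "\<tau> \<in> cells K" "incidence K \<tau> \<sigma> \<noteq> 0" for \<sigma> \<tau>
    using that fin_U[of \<sigma> "\<lambda>\<tau>. f \<tau> < f \<sigma>"]
    by (auto simp: weakly_critical_def U_snc_def not_less[symmetric])
  have D0: "f \<nu> \<le> f \<sigma>" if "\<sigma> \<in> ?W" "\<nu> \<in> cells K" "incidence K \<sigma> \<nu> \<noteq> 0" for \<sigma> \<nu>
    using that fin_D[of \<sigma> "\<lambda>\<nu>. f \<sigma> < f \<nu>"]
    by (auto simp: weakly_critical_def D_snc_def not_less[symmetric])
  have U1: "\<tau> = \<tau>'" if "\<sigma> \<in> cells K" "\<tau> \<in> cells K" "incidence K \<tau> \<sigma> \<noteq> 0" "f \<tau> < f \<sigma>"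
      "\<tau>' \<in> cells K" "incidence K \<tau>' \<sigma> \<noteq> 0" "f \<tau>' < f \<sigma>" for \<sigma> \<tau> \<tau>'
  proof -
    have "card {\<tau> \<in> cells K. incidence K \<tau> \<sigma> \<noteq> 0 \<and> f \<sigma> > f \<tau>} \<le> 1"
      using mb that(1) by (auto simp: discrete_morse_bott_def U_snc_def)
    then show ?thesis
      using that card_le_Suc0_iff_eq[OF fin_U[OF that(1), of "\<lambda>\<tau>. f \<tau> < f \<sigma>"]] by auto
  qed
  have D1: "\<nu> = \<nu>'" if "\<sigma> \<in> cells K" "\<nu> \<in> cells K" "incidence K \<sigma> \<nu> \<noteq> 0" "f \<sigma> < f \<nu>"
      "\<nu>' \<in> cells K" "incidence K \<sigma> \<nu>' \<noteq> 0" "f \<sigma> < f \<nu>'" for \<sigma> \<nu> \<nu>'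
  proof -
    have "card {\<nu> \<in> cells K. incidence K \<sigma> \<nu> \<noteq> 0 \<and> f \<sigma> < f \<nu>} \<le> 1"
      using mb that(1) by (auto simp: discrete_morse_bott_def D_snc_def)
    then show ?thesis
      using that card_le_Suc0_iff_eq[OF fin_D[OF that(1), of "\<lambda>\<nu>. f \<sigma> < f \<nu>"]] by auto
  qed
  have other: "\<exists>\<sigma>'\<in>cells K. \<sigma>' \<noteq> \<sigma> \<and> incidence K \<tau> \<sigma>' \<noteq> 0 \<and> incidence K \<sigma>' \<nu> \<noteq> 0"
    if "\<tau> \<in> cells K" "\<nu> \<in> cells K" "\<sigma> \<in> cells K" "incidence K \<tau> \<sigma> \<noteq> 0" "incidence K \<sigma> \<nu> \<noteq> 0"
    for \<tau> \<sigma> \<nu>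
  proof (rule ccontr)
    assume "\<not> ?thesis"
    then have "{\<sigma> \<in> cells K. incidence K \<tau> \<sigma> * incidence K \<sigma> \<nu> \<noteq> 0} = {\<sigma>}"
      using that by auto
    with d_square[OF that(1,2)] that(4,5) show False by simp
  qed
  have mid: "\<sigma> \<in> ?W \<and> f \<sigma> = f \<tau>"
    if \<tau>: "\<tau> \<in> ?W" and \<nu>: "\<nu> \<in> ?W" and eq: "f \<tau> = f \<nu>" and \<sigma>: "\<sigma> \<in> cells K"
      and w: "incidence K \<tau> \<sigma> \<noteq> 0" "incidence K \<sigma> \<nu> \<noteq> 0" for \<tau> \<sigma> \<nu>
  proof
    show f: "f \<sigma> = f \<tau>"
      using D0[OF \<tau> \<sigma> w(1)] U0[OF \<nu> \<sigma> w(2)] eq by simp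
    have "{\<rho> \<in> cells K. incidence K \<rho> \<sigma> \<noteq> 0 \<and> f \<sigma> > f \<rho>} = {}"
    proof (rule ccontr)
      assume "\<not> ?thesis"
      then obtain \<rho> where \<rho>: "\<rho> \<in> cells K" "incidence K \<rho> \<sigma> \<noteq> 0" "f \<rho> < f \<sigma>" by auto
      from other[of \<rho> \<nu> \<sigma>] \<rho> \<nu> \<sigma> w obtain \<sigma>' where \<sigma>': "\<sigma>' \<in> cells K" "\<sigma>' \<noteq> \<sigma>"
        "incidence K \<rho> \<sigma>' \<noteq> 0" "incidence K \<sigma>' \<nu> \<noteq> 0" by auto
      have "f \<sigma>' \<le> f \<rho>"
        using D1[OF \<rho>(1) \<sigma> \<rho>(2,3) \<sigma>'(1,3)] \<sigma>'(2) by force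
      with U0[OF \<nu> \<sigma>'(1,4)] \<rho>(3) f eq show False by simp
    qed
    moreover have "{\<rho> \<in> cells K. incidence K \<sigma> \<rho> \<noteq> 0 \<and> f \<sigma> < f \<rho>} = {}"
    proof (rule ccontr)
      assume "\<not> ?thesis"
      then obtain \<rho> where \<rho>: "\<rho> \<in> cells K" "incidence K \<sigma> \<rho> \<noteq> 0" "f \<sigma> < f \<rho>" by auto
      from other[of \<tau> \<rho> \<sigma>] \<rho> \<tau> \<sigma> w obtain \<sigma>' where \<sigma>': "\<sigma>' \<in> cells K" "\<sigma>' \<noteq> \<sigma>"
        "incidence K \<tau> \<sigma>' \<noteq> 0" "incidence K \<sigma>' \<rho> \<noteq> 0" by auto
      have "f \<rho> \<le> f \<sigma>'"
        using U1[OF \<rho>(1) \<sigma> \<rho>(2,3) \<sigma>'(1,4)] \<sigma>'(2) by force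
      with D0[OF \<tau> \<sigma>'(1,3)] \<rho>(3) f show False by simp
    qed
    ultimately show "\<sigma> \<in> ?W"
      using \<sigma> unfolding weakly_critical_def U_snc_def D_snc_def mem_Collect_eq
      by (simp only: card.empty) simp
  qed
  show ?thesis
  proof
    show "finite (k_cells (weakly_critical_complex K f) k)" for k
      by (rule finite_subset[OF _ finite_k_cells[of k]])
         (auto simp: k_cells_def weakly_critical_complex_def)
  next
    show "int (cell_dim (weakly_critical_complex K f) \<tau>)
        - int (cell_dim (weakly_critical_complex K f) \<sigma>) = 1"
      if "\<tau> \<in> cells (weakly_critical_complex K f)" "\<sigma> \<in> cells (weakly_critical_complex K f)"
        "incidence (weakly_critical_complex K f) \<tau> \<sigma> \<noteq> 0" for \<tau> \<sigma>
      using that incidence_dim[of \<tau> \<sigma>]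
      by (auto simp: weakly_critical_complex_def split: if_splits)
  next
    fix \<tau> \<nu>
    let ?w = "incidence (weakly_critical_complex K f)"
    assume "\<tau> \<in> cells (weakly_critical_complex K f)" "\<nu> \<in> cells (weakly_critical_complex K f)"
    then have \<tau>\<nu>: "\<tau> \<in> ?W" "\<nu> \<in> ?W" by (simp_all add: weakly_critical_complex_def)
    show "(\<Sum>\<sigma> | \<sigma> \<in> cells (weakly_critical_complex K f) \<and> ?w \<tau> \<sigma> * ?w \<sigma> \<nu> \<noteq> 0.
        ?w \<tau> \<sigma> * ?w \<sigma> \<nu>) = 0"
    proof (cases "f \<tau> = f \<nu>")
      case True
      have "{\<sigma> \<in> cells (weakly_critical_complex K f). ?w \<tau> \<sigma> * ?w \<sigma> \<nu> \<noteq> 0}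
          = {\<sigma> \<in> cells K. incidence K \<tau> \<sigma> * incidence K \<sigma> \<nu> \<noteq> 0}"
        using mid[OF \<tau>\<nu> True] True by (auto simp: weakly_critical_complex_def split: if_splits)
      moreover have "?w \<tau> \<sigma> * ?w \<sigma> \<nu> = incidence K \<tau> \<sigma> * incidence K \<sigma> \<nu>"
        if "\<sigma> \<in> cells K" "incidence K \<tau> \<sigma> * incidence K \<sigma> \<nu> \<noteq> 0" for \<sigma>
        using mid[OF \<tau>\<nu> True that(1)] that(2) True by (auto simp: weakly_critical_complex_def)
      ultimately show ?thesis
        using d_square[of \<tau> \<nu>] \<tau>\<nu> by simp
    next
      case False
      then have "?w \<tau> \<sigma> * ?w \<sigma> \<nu> = 0" for \<sigma>
        by (simp add: weakly_critical_complex_def)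
      then show ?thesis by simp
    qed
  qed
qed

definition d_snc :: "'a cell_complex \<Rightarrow> ('a \<Rightarrow> real) \<Rightarrow> nat \<Rightarrow> nat" where
  "d_snc K f k = card {\<sigma> \<in> k_cells K k. D_snc K f \<sigma> = 1}"

(* A formal power series, since the cell dimensions may be unbounded;
   its coefficient at index n is that of t^(k-1) with k = n + 1. *)
definition R_series :: "'a cell_complex \<Rightarrow> ('a \<Rightarrow> real) \<Rightarrow> int fps" where
  "R_series K f = Abs_fps (\<lambda>n.
     int (dim (boundaries K n)) - int (d_snc K f (n + 1))
       - int (dim (boundaries (weakly_critical_complex K f) n)))"

end

theory Submission
  imports Defs
begin

text \<open>
  A function on a Lefschetz complex enters all three conclusions only through the comparison of
  its values on pairs of incident cells. The counts \<open>U_snc\<close> and \<open>D_snc\<close> are cardinalities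
  of sets cut out by such comparisons, so the hypothesis makes them agree for \<open>f\<close> and \<open>g\<close>; this
  settles the Morse-Bott property, the set of weakly critical cells and the numbers \<open>d_snc\<close>.
  The incidence function of the weakly critical complex depends on whether the two values are
  equal. As incidence is allowed in either order in the hypothesis, it can be applied to
  \<open>(\<alpha>, \<beta>)\<close> and to \<open>(\<beta>, \<alpha>)\<close>, and trichotomy of the order on the reals turns agreement of the
  strict inequalities into agreement of the equalities. The two weakly critical complexes are
  therefore equal, and equal complexes have the same boundary spaces, whence the same ranks in
  the series.
\<close>

lemma U_snc_cong:
  assumes "\<And>\<tau>. \<tau> \<in> cells K \<Longrightarrow> incidence K \<tau> \<sigma> \<noteq> 0 \<Longrightarrow> f \<tau> < f \<sigma> \<longleftrightarrow> g \<tau> < g \<sigma>"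
  shows "U_snc K f \<sigma> = U_snc K g \<sigma>"
  unfolding U_snc_def using assms by (intro arg_cong[where f = card] Collect_cong) blast

lemma D_snc_cong:
  assumes "\<And>\<nu>. \<nu> \<in> cells K \<Longrightarrow> incidence K \<sigma> \<nu> \<noteq> 0 \<Longrightarrow> f \<sigma> < f \<nu> \<longleftrightarrow> g \<sigma> < g \<nu>"
  shows "D_snc K f \<sigma> = D_snc K g \<sigma>"
  unfolding D_snc_def using assms by (intro arg_cong[where f = card] Collect_cong) blast

lemma k_cells_lefschetz_eq:
  "lefschetz_eq K L \<Longrightarrow> k_cells K k = k_cells L k"
  by (auto simp: lefschetz_eq_def k_cells_def)

text \<open>
  Equality of complexes says nothing about the record components off the cell set. The boundary
  operators need not coincide as functions on all finitely supported functions; they do on chains,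
  because only incidences between cells enter there.
\<close>

lemma boundary_lefschetz_eq:
  assumes eq: "lefschetz_eq K L" and c: "c \<in> chain_space K k"
  shows "boundary K k c = boundary L k c"
proof -
  have faces: "{\<sigma> \<in> cells K. cell_dim K \<sigma> + 1 = k} = {\<sigma> \<in> cells L. cell_dim L \<sigma> + 1 = k}"
    using eq by (auto simp: lefschetz_eq_def)
  have "incidence K \<tau> \<sigma> = incidence L \<tau> \<sigma>"
    if "\<tau> \<in> Poly_Mapping.keys c" "\<sigma> \<in> {\<sigma> \<in> cells L. cell_dim L \<sigma> + 1 = k}" for \<tau> \<sigma>
    using that eq c by (auto simp: lefschetz_eq_def chain_space_def k_cells_def)
  then show ?thesis
    unfolding boundary_def faces by simp
qed

lemma boundaries_lefschetz_eq:
  assumes "lefschetz_eq K L"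
  shows "boundaries K k = boundaries L k"
proof -
  have "chain_space K (k + 1) = chain_space L (k + 1)"
    by (simp only: chain_space_def k_cells_lefschetz_eq[OF assms])
  then show ?thesis
    unfolding boundaries_def using boundary_lefschetz_eq[OF assms] by (intro image_cong) auto
qed

theorem proposition5p10:
  fixes K :: "'a cell_complex" and f g :: "'a \<Rightarrow> real"
  assumes "lefschetz_complex K"
    and "discrete_morse_bott K f"
    and "\<And>\<alpha> \<beta>. \<lbrakk>\<alpha> \<in> cells K; \<beta> \<in> cells K; incidence K \<alpha> \<beta> \<noteq> 0 \<or> incidence K \<beta> \<alpha> \<noteq> 0\<rbrakk>
           \<Longrightarrow> f \<alpha> < f \<beta> \<longleftrightarrow> g \<alpha> < g \<beta>"
  shows "discrete_morse_bott K g
    \<and> lefschetz_eq (weakly_critical_complex K f) (weakly_critical_complex K g)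
    \<and> R_series K f = R_series K g"
proof -
  have U: "U_snc K f \<sigma> = U_snc K g \<sigma>" if "\<sigma> \<in> cells K" for \<sigma>
    by (rule U_snc_cong) (use assms(3) that in blast)
  have D: "D_snc K f \<sigma> = D_snc K g \<sigma>" if "\<sigma> \<in> cells K" for \<sigma>
    by (rule D_snc_cong) (use assms(3) that in blast)
  have level: "f \<tau> = f \<sigma> \<longleftrightarrow> g \<tau> = g \<sigma>"
    if "\<tau> \<in> cells K" "\<sigma> \<in> cells K" "incidence K \<tau> \<sigma> \<noteq> 0" for \<tau> \<sigma>
    using assms(3)[of \<tau> \<sigma>] assms(3)[of \<sigma> \<tau>] that by (metis linorder_neq_iff)
  have mb: "discrete_morse_bott K g"
    using assms(2) U D by (simp add: discrete_morse_bott_def)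
  have W: "lefschetz_eq (weakly_critical_complex K f) (weakly_critical_complex K g)"
    unfolding lefschetz_eq_def weakly_critical_complex_def weakly_critical_def
    using U D level by auto
  have "d_snc K f k = d_snc K g k" for k
    unfolding d_snc_def k_cells_def using D
    by (intro arg_cong[where f = card] Collect_cong) auto
  then have "R_series K f = R_series K g"
    unfolding R_series_def boundaries_lefschetz_eq[OF W] by simp
  with mb W show ?thesis by blast
qed

end
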